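(* Let $\{F_N\}_{N\ge N_{min}}$, $F_N\in\mathbb{C}[[t_1,\dots,t_N]]$, be an infinite series of $N$-dimensional Frobenius manifold potentials satisfying the stabilization condition, and let $R_{\alpha,\beta;\gamma_1,\dots,\gamma_m}\in\mathbb{C}$ ($m,\alpha,\beta,\gamma_i\in\mathbb{Z}_{\ge1}$) be the associated stable coefficients. Then the system of PDEs on a function $f=f(t_1,t_2,\dots)$ $$\partial_\alpha\partial_\beta f=\sum_{m\ge1}\ \sum_{\gamma_1,\dots,\gamma_m\ge1}R_{\alpha,\beta;\gamma_1,\dots,\gamma_m}\,\partial_1\partial_{\gamma_1}f\cdots\partial_1\partial_{\gamma_m}f,\qquad \alpha,\beta\ge1,$$ is compatible.
   Context: Notation: $\partial_\alpha=\partial/\partial t_\alpha$. Frobenius manifold potential (dimension $N$): a function $F_N=F_N(t_1,\dots,t_N)$ such that (i) $\partial F_N/\partial t_1=\frac12\sum_{\alpha,\beta=1}^N\eta_{\alpha,\beta}t_\alpha t_\beta$ for a constant non-degenerate symmetric matrix $\eta=(\eta_{\alpha,\beta})$, with inverse $(\eta^{\alpha,\beta})$; (ii) the WDVV equations hold for all $1\le\alpha,\beta,\gamma,\sigma\le N$: $$\sum_{\mu,\nu=1}^N\frac{\partial^3F_N}{\partial t_\alpha\partial t_\beta\partial t_\mu}\eta^{\mu,\nu}\frac{\partial^3F_N}{\partial t_\nu\partial t_\gamma\partial t_\sigma}=\sum_{\mu,\nu=1}^N\frac{\partial^3F_N}{\partial t_\alpha\partial t_\gamma\partial t_\mu}\eta^{\mu,\nu}\frac{\partial^3F_N}{\partial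 t_\nu\partial t_\beta\partial t_\sigma};$$ (iii) there is an Euler vector field $E=\sum_k d_kt_k\partial_k$, $d_1=1$, with $E\cdot F_N=(3-\delta)F_N$ modulo quadratic terms in the $t$'s, for some $\delta\in\mathbb{C}$. The coordinates are assumed to be such that each row of $\eta$ has exactly one nonzero entry. Write $s_\alpha=s^{(N)}_\alpha:=\partial_1\partial_\alpha F_N=\sum_\beta\eta_{\alpha,\beta}t_\beta$ for $1\le\alpha\le N$ (in the usual notation $s_\alpha=t_{\bar\alpha}$); these are linear coordinates. Stabilization condition: there exist $\kappa_1,\kappa_0\in\mathbb{Q}$ with $\kappa_1>0$ and numbers $R_{\alpha,\beta;\gamma_1,\dots,\gamma_m}$ not depending on $N$, symmetric in $\alpha,\beta$ and under permutations of the $\gamma_i$, such that for every $N\ge N_{min}$ and all $1\le\alpha,\beta\le N$ with $\alpha+\beta\le\kappa_1N+\kappa_0$ one has $$\partial_\alpha\partial_\beta F_N=\sum_{m\ge1}\ \sum_{1\le\gamma_1,\dots,\gamma_m\le N}R_{\alpha,\beta;\gamma_1,\dots,\gamma_m}\,s^{(N)}_{\gamma_1}\cdots s^{(N)}_{\gamma_m},$$ and moreover $R_{\alpha,\beta;\gamma_1,\dots,\gamma_m}=0$ whenever some $\gamma_i>N$ for such an $N$. Equivalently, $R_{\alpha,\beta;\gamma_1,\dots,\gamma_m}=\frac1{m!}\,\frac{\partial^m(\partial_\alpha\partial_\beta F_N)}{\partial s_{\gamma_1}\cdots\partial s_{\gamma_m}}\big|_{t=0}$ for all sufficiently large $N$.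 In particular, for fixed $\alpha,\beta$ only finitely many indices $\gamma$ occur in nonzero $R_{\alpha,\beta;\bullet}$. Compatibility means that $\partial_\gamma(\partial_\alpha\partial_\beta f)=\partial_\beta(\partial_\alpha\partial_\gamma f)$ holds identically for all $\alpha,\beta,\gamma\ge1$ when the expressions in brackets are replaced by the right-hand sides of the system, and the resulting derivatives $\partial_\gamma\partial_1\partial_\nu f=\partial_1(\partial_\nu\partial_\gamma f)$ (resp. with $\beta$ in place of $\gamma$) are again computed with the help of the system; the identity is one of formal power series in the independent symbols $p_\nu=\partial_1\partial_\nu f$, linear in the independent symbols $q_\kappa=\partial_1\partial_1\partial_\kappa f$. Explicitly, with $Q_{\alpha\beta}(p)=\sum_{m\ge1}\sum_{\gamma_1,\dots,\gamma_m}R_{\alpha,\beta;\gamma_1,\dots,\gamma_m}p_{\gamma_1}\cdots p_{\gamma_m}$, it says that for all $\alpha,\beta,\gamma,\kappa\ge1$ $$\sum_{\nu\ge1}\frac{\partial Q_{\alpha\beta}}{\partial p_\nu}\frac{\partial Q_{\nu\gamma}}{\partial p_\kappa}=\sum_{\nu\ge1}\frac{\partial Q_{\alpha\gamma}}{\partial p_\nu}\frac{\partial Q_{\nu\beta}}{\partial p_\kappa}.$$ *)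

theory Defs
  imports Complex_Main "HOL-Library.Multiset"
begin

section \<open>Multivariate formal power series\<close>

text \<open>
  A monomial in the (possibly infinitely many) variables \<open>'v\<close> is a finite multiset of variables;
  a power series is an arbitrary family of coefficients indexed by monomials.
\<close>

typedef ('v, 'a) mps = "UNIV :: ('v multiset \<Rightarrow> 'a) set"
  morphisms mps_nth Abs_mps ..

setup_lifting type_definition_mps

lemma mps_eqI: "(\<And>M. mps_nth F M = mps_nth G M) \<Longrightarrow> F = G"
  by transfer auto

lemma finite_submultisets: "finite {A. A \<subseteq># M}"
proof (rule finite_subset)
  show "{A. A \<subseteq># M} \<subseteq> mset ` {xs. set xs \<subseteq> set_mset M \<and> length xs \<le> size M}"
  proof
    fix A assume A: "A \<in> {A. A \<subseteq># M}"
    obtain xs where xs: "mset xs = A" using ex_mset by blast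
    have "set xs \<subseteq> set_mset M" using A xs set_mset_mono by fastforce
    moreover have "length xs \<le> size M"
      using A xs size_mset_mono by fastforce
    ultimately show "A \<in> mset ` {xs. set xs \<subseteq> set_mset M \<and> length xs \<le> size M}"
      using xs by blast
  qed
  show "finite (mset ` {xs. set xs \<subseteq> set_mset M \<and> length xs \<le> size M})"
    by (intro finite_imageI finite_lists_length_le) simp
qed

instantiation mps :: (type, comm_ring_1) comm_ring_1
begin

lift_definition zero_mps :: "('a, 'b) mps" is "\<lambda>_. 0" .
lift_definition one_mps :: "('a, 'b) mps" is "\<lambda>M. if M = {#} then 1 else 0" .
lift_definition plus_mps :: "('a, 'b) mps \<Rightarrow> ('a, 'b) mps \<Rightarrow> ('a, 'b) mps"
  is "\<lambda>F G M. F M + G M" .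
lift_definition minus_mps :: "('a, 'b) mps \<Rightarrow> ('a, 'b) mps \<Rightarrow> ('a, 'b) mps"
  is "\<lambda>F G M. F M - G M" .
lift_definition uminus_mps :: "('a, 'b) mps \<Rightarrow> ('a, 'b) mps"
  is "\<lambda>F M. - F M" .
lift_definition times_mps :: "('a, 'b) mps \<Rightarrow> ('a, 'b) mps \<Rightarrow> ('a, 'b) mps"
  is "\<lambda>F G M. \<Sum>A | A \<subseteq># M. F A * G (M - A)" .

instance
proof
  fix F G H :: "('a, 'b) mps"
  show "F * G * H = F * (G * H)"
  proof (transfer, rule ext)
    fix F G H :: "'a multiset \<Rightarrow> 'b" and M
    have "(\<Sum>A | A \<subseteq># M. (\<Sum>B | B \<subseteq># A. F B * G (A - B)) * H (M - A)) =
          (\<Sum>(A, B)\<in>(SIGMA A:{A. A \<subseteq># M}. {B. B \<subseteq># A}). F B * G (A - B) * H (M - A))"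
      by (simp add: sum_distrib_right sum.Sigma finite_submultisets)
    also have "\<dots> = (\<Sum>(B, C)\<in>(SIGMA B:{B. B \<subseteq># M}. {C. C \<subseteq># M - B}).
                     F B * (G C * H (M - B - C)))"
      by (rule sum.reindex_bij_witness[where i = "\<lambda>(B, C). (B + C, B)" and j = "\<lambda>(A, B). (B, A - B)"])
         (auto simp: mult.assoc subset_mset.le_diff_conv2 subset_mset.add_diff_inverse
               intro: subset_mset.order_trans simp: add.commute subset_mset.diff_add)
    also have "\<dots> = (\<Sum>B | B \<subseteq># M. F B * (\<Sum>C | C \<subseteq># M - B. G C * H (M - B - C)))"
      by (simp add: sum_distrib_left sum.Sigma finite_submultisets)
    finally show "(\<Sum>A | A \<subseteq># M. (\<Sum>B | B \<subseteq># A. F B * G (A - B)) * H (M - A)) =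
                  (\<Sum>B | B \<subseteq># M. F B * (\<Sum>C | C \<subseteq># M - B. G C * H (M - B - C)))" .
  qed
  show "F * G = G * F"
  proof (transfer, rule ext)
    fix F G :: "'a multiset \<Rightarrow> 'b" and M
    show "(\<Sum>A | A \<subseteq># M. F A * G (M - A)) = (\<Sum>A | A \<subseteq># M. G A * F (M - A))"
      by (rule sum.reindex_bij_witness[where i = "\<lambda>A. M - A" and j = "\<lambda>A. M - A"])
         (auto simp: mult.commute subset_mset.diff_diff_right)
  qed
  show "1 * F = F"
  proof (transfer, rule ext)
    fix F :: "'a multiset \<Rightarrow> 'b" and M
    have "(\<Sum>A | A \<subseteq># M. (if A = {#} then 1 else 0) * F (M - A)) =
          (\<Sum>A | A \<subseteq># M. if A = {#} then F (M - A) else 0)"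
      by (intro sum.cong) auto
    also have "\<dots> = F M"
      by (simp add: sum.delta' finite_submultisets)
    finally show "(\<Sum>A | A \<subseteq># M. (if A = {#} then 1 else 0) * F (M - A)) = F M" .
  qed
  show "(F + G) * H = F * H + G * H"
    by transfer (simp add: distrib_right sum.distrib)
  show "(0 :: ('a, 'b) mps) \<noteq> 1"
    by transfer (auto simp: fun_eq_iff)
qed (transfer; auto simp: fun_eq_iff add_ac; fail)+

end

lift_definition mps_const :: "'a \<Rightarrow> ('v, 'a::comm_ring_1) mps"
  is "\<lambda>c M. if M = {#} then c else 0" .

lift_definition mps_var :: "'v \<Rightarrow> ('v, 'a::comm_ring_1) mps"
  is "\<lambda>v M. if M = {#v#} then 1 else 0" .

lift_definition mps_deriv :: "'v \<Rightarrow> ('v, 'a::comm_ring_1) mps \<Rightarrow> ('v, 'a) mps"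
  is "\<lambda>v F M. of_nat (count M v + 1) * F (add_mset v M)" .

definition mps_summable :: "('i \<Rightarrow> ('v, 'a::comm_ring_1) mps) \<Rightarrow> 'i set \<Rightarrow> bool" where
  "mps_summable X I \<longleftrightarrow> (\<forall>M. finite {i\<in>I. mps_nth (X i) M \<noteq> 0})"

text \<open>The formal sum is computed coefficientwise; it is meaningful for summable families only.\<close>

definition mps_infsum :: "('i \<Rightarrow> ('v, 'a::comm_ring_1) mps) \<Rightarrow> 'i set \<Rightarrow> ('v, 'a) mps" where
  "mps_infsum X I = Abs_mps (\<lambda>M. \<Sum>i | i \<in> I \<and> mps_nth (X i) M \<noteq> 0. mps_nth (X i) M)"


section \<open>Frobenius manifold potentials\<close>

text \<open>
  The variable \<open>t\<^sub>\<alpha>\<close> is \<open>mps_var \<alpha>\<close>; only indices \<open>\<ge> 1\<close> are used. Condition (iii) leaves the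
  coefficients of all monomials of degree at most two unconstrained.
\<close>

definition frobenius_potential ::
    "nat \<Rightarrow> (nat \<Rightarrow> nat \<Rightarrow> complex) \<Rightarrow> (nat, complex) mps \<Rightarrow> bool" where
  "frobenius_potential N \<eta> F \<longleftrightarrow>
     (\<forall>M. mps_nth F M \<noteq> 0 \<longrightarrow> set_mset M \<subseteq> {1..N}) \<and>
     (\<forall>\<alpha>\<in>{1..N}. \<forall>\<beta>\<in>{1..N}. \<eta> \<alpha> \<beta> = \<eta> \<beta> \<alpha>) \<and>
     mps_deriv 1 F =
       mps_const (1/2) * (\<Sum>\<alpha>=1..N. \<Sum>\<beta>=1..N. mps_const (\<eta> \<alpha> \<beta>) * mps_var \<alpha> * mps_var \<beta>) \<and>
     (\<exists>\<eta>inv.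
        (\<forall>\<alpha>\<in>{1..N}. \<forall>\<beta>\<in>{1..N}.
           (\<Sum>\<mu>=1..N. \<eta> \<alpha> \<mu> * \<eta>inv \<mu> \<beta>) = (if \<alpha> = \<beta> then 1 else 0) \<and>
           (\<Sum>\<mu>=1..N. \<eta>inv \<alpha> \<mu> * \<eta> \<mu> \<beta>) = (if \<alpha> = \<beta> then 1 else 0)) \<and>
        (\<forall>\<alpha>\<in>{1..N}. \<forall>\<beta>\<in>{1..N}. \<forall>\<gamma>\<in>{1..N}. \<forall>\<sigma>\<in>{1..N}.
           (\<Sum>\<mu>=1..N. \<Sum>\<nu>=1..N.
              mps_deriv \<alpha> (mps_deriv \<beta> (mps_deriv \<mu> F)) * mps_const (\<eta>inv \<mu> \<nu>) *
              mps_deriv \<nu> (mps_deriv \<gamma> (mps_deriv \<sigma> F))) =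
           (\<Sum>\<mu>=1..N. \<Sum>\<nu>=1..N.
              mps_deriv \<alpha> (mps_deriv \<gamma> (mps_deriv \<mu> F)) * mps_const (\<eta>inv \<mu> \<nu>) *
              mps_deriv \<nu> (mps_deriv \<beta> (mps_deriv \<sigma> F))))) \<and>
     (\<exists>d \<delta>. d 1 = 1 \<and>
        (\<forall>M. size M > 2 \<longrightarrow>
           mps_nth ((\<Sum>k=1..N. mps_const (d k) * mps_var k * mps_deriv k F)
                    - mps_const (3 - \<delta>) * F) M = 0))"

definition one_nonzero_entry_per_row :: "nat \<Rightarrow> (nat \<Rightarrow> nat \<Rightarrow> complex) \<Rightarrow> bool" where
  "one_nonzero_entry_per_row N \<eta> \<longleftrightarrow>
     (\<forall>\<alpha>\<in>{1..N}. \<exists>!\<beta>. \<beta> \<in> {1..N} \<and> \<eta> \<alpha> \<beta> \<noteq> 0)"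


section \<open>Stabilization\<close>

text \<open>
  Coefficients \<open>R\<^bsub>\<alpha>,\<beta>;\<gamma>\<^sub>1,\<dots>,\<gamma>\<^sub>m\<^esub>\<close> are written \<open>R \<alpha> \<beta> [\<gamma>\<^sub>1, \<dots>, \<gamma>\<^sub>m]\<close>. The following is the series
  \<open>\<Sum>\<^sub>m\<^sub>\<ge>\<^sub>1 \<Sum> R\<^bsub>\<alpha>,\<beta>;\<gamma>\<^sub>1,\<dots>,\<gamma>\<^sub>m\<^esub> x\<^bsub>\<gamma>\<^sub>1\<^esub> \<cdots> x\<^bsub>\<gamma>\<^sub>m\<^esub>\<close>, where the inner sum extends over all \<open>\<gamma>\<^sub>1, \<dots>, \<gamma>\<^sub>m \<in> \<Gamma>\<close>.
\<close>

definition coeff_series ::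
    "(nat \<Rightarrow> nat \<Rightarrow> nat list \<Rightarrow> complex) \<Rightarrow> nat \<Rightarrow> nat \<Rightarrow> nat set \<Rightarrow> (nat \<Rightarrow> ('v, complex) mps)
      \<Rightarrow> ('v, complex) mps" where
  "coeff_series R \<alpha> \<beta> \<Gamma> x =
     mps_infsum (\<lambda>\<gamma>s. mps_const (R \<alpha> \<beta> \<gamma>s) * prod_list (map x \<gamma>s)) {\<gamma>s. \<gamma>s \<noteq> [] \<and> set \<gamma>s \<subseteq> \<Gamma>}"

definition stable_coefficients ::
    "nat \<Rightarrow> (nat \<Rightarrow> (nat, complex) mps) \<Rightarrow> (nat \<Rightarrow> nat \<Rightarrow> nat list \<Rightarrow> complex) \<Rightarrow> bool" where
  "stable_coefficients Nmin F R \<longleftrightarrow>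
     (\<forall>\<alpha>\<ge>1. \<forall>\<beta>\<ge>1. \<forall>\<gamma>s. set \<gamma>s \<subseteq> {1..} \<longrightarrow> R \<alpha> \<beta> \<gamma>s = R \<beta> \<alpha> \<gamma>s) \<and>
     (\<forall>\<alpha>\<ge>1. \<forall>\<beta>\<ge>1. \<forall>\<gamma>s \<gamma>s'. set \<gamma>s \<subseteq> {1..} \<longrightarrow> mset \<gamma>s = mset \<gamma>s' \<longrightarrow> R \<alpha> \<beta> \<gamma>s = R \<alpha> \<beta> \<gamma>s') \<and>
     (\<exists>\<kappa>\<^sub>1 \<kappa>\<^sub>0 :: rat. \<kappa>\<^sub>1 > 0 \<and>
        (\<forall>N\<ge>Nmin. \<forall>\<alpha>\<in>{1..N}. \<forall>\<beta>\<in>{1..N}. of_nat (\<alpha> + \<beta>) \<le> \<kappa>\<^sub>1 * of_nat N + \<kappa>\<^sub>0 \<longrightarrow>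
           mps_deriv \<alpha> (mps_deriv \<beta> (F N)) =
             coeff_series R \<alpha> \<beta> {1..N} (\<lambda>\<gamma>. mps_deriv 1 (mps_deriv \<gamma> (F N))) \<and>
           (\<forall>\<gamma>s. set \<gamma>s \<subseteq> {1..} \<and> (\<exists>\<gamma>\<in>set \<gamma>s. \<gamma> > N) \<longrightarrow> R \<alpha> \<beta> \<gamma>s = 0)))"


section \<open>Compatibility of the stable system\<close>

text \<open>\<open>JP \<nu>\<close> stands for \<open>p\<^sub>\<nu> = \<partial>\<^sub>1\<partial>\<^sub>\<nu>f\<close> and \<open>JQ \<kappa>\<close> for \<open>q\<^sub>\<kappa> = \<partial>\<^sub>1\<partial>\<^sub>1\<partial>\<^sub>\<kappa>f\<close>.\<close>

datatype jet = JP nat | JQ nat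

definition system_rhs ::
    "(nat \<Rightarrow> nat \<Rightarrow> nat list \<Rightarrow> complex) \<Rightarrow> nat \<Rightarrow> nat \<Rightarrow> (jet, complex) mps" where
  "system_rhs R \<alpha> \<beta> = coeff_series R \<alpha> \<beta> {1..} (\<lambda>\<gamma>. mps_var (JP \<gamma>))"

text \<open>
  The chain rule for series in the \<open>p\<^sub>\<nu>\<close>, where \<open>v \<nu>\<close> is the derivative of \<open>p\<^sub>\<nu>\<close>:
  \<open>\<partial>\<^sub>1p\<^sub>\<kappa> = q\<^sub>\<kappa>\<close>, and \<open>\<partial>\<^sub>\<gamma>p\<^sub>\<nu> = \<partial>\<^sub>1(\<partial>\<^sub>\<nu>\<partial>\<^sub>\<gamma>f)\<close> is computed by means of the system.
\<close>

definition chain_term ::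
    "(nat \<Rightarrow> (jet, complex) mps) \<Rightarrow> (jet, complex) mps \<Rightarrow> nat \<Rightarrow> (jet, complex) mps" where
  "chain_term v X \<nu> = mps_deriv (JP \<nu>) X * v \<nu>"

definition jet_d1 :: "(jet, complex) mps \<Rightarrow> (jet, complex) mps" where
  "jet_d1 X = mps_infsum (chain_term (\<lambda>\<kappa>. mps_var (JQ \<kappa>)) X) {1..}"

definition jet_d ::
    "(nat \<Rightarrow> nat \<Rightarrow> nat list \<Rightarrow> complex) \<Rightarrow> nat \<Rightarrow> (jet, complex) mps \<Rightarrow> (jet, complex) mps" where
  "jet_d R \<gamma> X = mps_infsum (chain_term (\<lambda>\<nu>. jet_d1 (system_rhs R \<nu> \<gamma>)) X) {1..}"

text \<open>The first two conjuncts say that all infinite sums in the third are well defined.\<close>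

definition compatible_system :: "(nat \<Rightarrow> nat \<Rightarrow> nat list \<Rightarrow> complex) \<Rightarrow> bool" where
  "compatible_system R \<longleftrightarrow>
     (\<forall>\<alpha>\<ge>1. \<forall>\<beta>\<ge>1. \<forall>\<gamma>\<ge>1.
        mps_summable (chain_term (\<lambda>\<kappa>. mps_var (JQ \<kappa>)) (system_rhs R \<alpha> \<beta>)) {1..} \<and>
        mps_summable (chain_term (\<lambda>\<nu>. jet_d1 (system_rhs R \<nu> \<gamma>)) (system_rhs R \<alpha> \<beta>)) {1..} \<and>
        jet_d R \<gamma> (system_rhs R \<alpha> \<beta>) = jet_d R \<beta> (system_rhs R \<alpha> \<gamma>))"

end

theory Submission
  imports Defs
begin

text \<open>
  For stable \<open>(\<alpha>, \<beta>)\<close> the series \<open>\<partial>\<^sub>\<alpha>\<partial>\<^sub>\<beta>F\<^sub>N\<close> is \<open>Q\<^bsub>\<alpha>\<beta>\<^esub>(s)\<close>, and by the chain rule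
  \<open>\<Sum>\<^sub>\<mu> \<partial>\<^sub>\<alpha>\<partial>\<^sub>\<beta>\<partial>\<^sub>\<mu>F\<^sub>N \<eta>\<^bsup>\<mu>\<nu>\<^esup> = (\<partial>Q\<^bsub>\<alpha>\<beta>\<^esub>/\<partial>p\<^sub>\<nu>)(s)\<close>. Only finitely many \<open>p\<^sub>\<nu>\<close> occur in \<open>Q\<^bsub>\<alpha>\<beta>\<^esub>\<close> and
  \<open>Q\<^bsub>\<alpha>\<gamma>\<^esub>\<close>; once \<open>N\<close> is so large that the pairs \<open>(\<nu>, \<gamma>)\<close> and \<open>(\<nu>, \<beta>)\<close> are stable for all these \<open>\<nu>\<close>,
  the WDVV equations of \<open>F\<^sub>N\<close> become the compatibility equations for \<open>Q\<close>, evaluated at \<open>p = s\<close>. As the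
  \<open>s\<^sub>\<alpha>\<close> are linear coordinates, the equations hold identically.
\<close>

section \<open>Formal power series\<close>

lemmas mps_nth_simps [simp] =
  zero_mps.rep_eq one_mps.rep_eq plus_mps.rep_eq
  mps_const.rep_eq mps_var.rep_eq mps_deriv.rep_eq

lemma mps_nth_sum [simp]: "mps_nth (sum f A) M = (\<Sum>i\<in>A. mps_nth (f i) M)"
  by (induction A rule: infinite_finite_induct) auto

lemma mps_nth_const_mult [simp]: "mps_nth (mps_const c * F) M = c * mps_nth F M"
proof -
  have "mps_nth (mps_const c * F) M = (\<Sum>A | A \<subseteq># M. if A = {#} then c * mps_nth F M else 0)"
    unfolding times_mps.rep_eq by (intro sum.cong) auto
  then show ?thesis by (simp add: sum.delta' finite_submultisets)
qed

lemma mps_nth_var_mult: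
  "mps_nth (mps_var v * F) M = (if v \<in># M then mps_nth F (M - {#v#}) else 0)"
proof -
  have "mps_nth (mps_var v * F) M = (\<Sum>A | A \<subseteq># M. if A = {#v#} then mps_nth F (M - {#v#}) else 0)"
    unfolding times_mps.rep_eq by (intro sum.cong) auto
  then show ?thesis by (simp add: sum.delta' finite_submultisets)
qed

lemma mps_nth_prod_list_var:
  "mps_nth (prod_list (map mps_var vs)) M = (if M = mset vs then 1 else 0)"
proof (induction vs arbitrary: M)
  case (Cons v vs)
  have "v \<in># M \<and> M - {#v#} = mset vs \<longleftrightarrow> M = mset (v # vs)"
    by (metis add_mset_remove_trivial insert_DiffM mset.simps(2) union_single_eq_member)
  with Cons show ?case by (auto simp: mps_nth_var_mult)
qed simp

lemma mps_const_0 [simp]: "mps_const 0 = 0"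
  and mps_const_1 [simp]: "mps_const 1 = 1"
  by (auto intro: mps_eqI)

lemma mps_const_mult: "mps_const (a * b) = mps_const a * mps_const b"
  by (auto intro: mps_eqI)

lemma mps_const_mult_left_cancel:
  fixes c :: "'a::idom"
  shows "c \<noteq> 0 \<Longrightarrow> mps_const c * F = mps_const c * G \<longleftrightarrow> F = G"
  by (metis mps_eqI mps_nth_const_mult mult_left_cancel)

lemma mps_deriv_const_mult: "mps_deriv v (mps_const c * F) = mps_const c * mps_deriv v F"
  and mps_deriv_sum: "mps_deriv v (sum f A) = (\<Sum>i\<in>A. mps_deriv v (f i))"
  by (auto intro!: mps_eqI simp: sum_distrib_left distrib_left mult.left_commute)

lemma mps_deriv_commute: "mps_deriv u (mps_deriv v F) = mps_deriv v (mps_deriv u F)"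
  by (cases "u = v") (auto intro!: mps_eqI simp: add_mset_commute)

text \<open>The product rule for quadratic monomials, all that condition (i) on the potential
  requires. When \<open>u = v = w\<close> both conditionals contribute, which matches the
  multiplicity factor 2 of the formal derivative.\<close>

lemma mps_deriv_var_mult_var:
  "mps_deriv u (mps_var v * mps_var w) =
     (if u = v then mps_var w else 0) + (if u = w then mps_var v else 0)"
proof (rule mps_eqI)
  fix M
  have *: "add_mset u M - {#v#} = {#w#} \<and> v \<in># add_mset u M \<longleftrightarrow> add_mset u M = {#v, w#}"
    by (metis add_mset_remove_trivial insert_DiffM union_single_eq_member)
  have "mps_nth (mps_var v * mps_var w) (add_mset u M) = (if add_mset u M = {#v, w#} then 1 else (0::'b))"
    unfolding mps_nth_var_mult using * by auto
  then show "mps_nth (mps_deriv u (mps_var v * mps_var w)) M =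
      mps_nth ((if u = v then mps_var w else 0) + (if u = w then mps_var v else 0) :: ('a, 'b) mps) M"
    by (auto simp: add_eq_conv_ex)
qed

section \<open>Formal infinite sums\<close>

lemma mps_nth_infsum:
  "mps_nth (mps_infsum X I) M = (\<Sum>i | i \<in> I \<and> mps_nth (X i) M \<noteq> 0. mps_nth (X i) M)"
  by (simp add: mps_infsum_def Abs_mps_inverse)

lemma mps_infsum_cong:
  "(\<And>i. i \<in> I \<Longrightarrow> X i = Y i) \<Longrightarrow> mps_infsum X I = mps_infsum Y I"
  by (intro mps_eqI) (auto simp: mps_nth_infsum intro!: sum.cong)

lemma mps_infsum_mono_neutral:
  assumes "J \<subseteq> I" "\<And>i. i \<in> I - J \<Longrightarrow> X i = 0"
  shows "mps_infsum X I = mps_infsum X J"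
proof -
  have "i \<in> I \<and> mps_nth (X i) M \<noteq> 0 \<longleftrightarrow> i \<in> J \<and> mps_nth (X i) M \<noteq> 0" for i M
    using assms by (metis DiffI mps_nth_simps(1) subsetD)
  then show ?thesis by (intro mps_eqI) (simp add: mps_nth_infsum)
qed

lemma mps_infsum_finite: "finite I \<Longrightarrow> mps_infsum X I = sum X I"
  by (intro mps_eqI) (auto simp: mps_nth_infsum intro!: sum.mono_neutral_left)

lemma mps_summable_finite_support:
  assumes "finite J" "\<And>i. i \<in> I - J \<Longrightarrow> X i = 0"
  shows "mps_summable X I"
  unfolding mps_summable_def
proof
  fix M
  have "{i \<in> I. mps_nth (X i) M \<noteq> 0} \<subseteq> J" using assms(2) by fastforce
  then show "finite {i \<in> I. mps_nth (X i) M \<noteq> 0}" using assms(1) finite_subset by blast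
qed


section \<open>Renaming and scaling of variables\<close>

text \<open>The substitution \<open>x\<^sub>v \<mapsto> c v \<cdot> x\<^bsub>b v\<^esub>\<close>; it is meaningful for injective \<open>b\<close> only.\<close>

definition mps_rename ::
    "('v \<Rightarrow> 'w) \<Rightarrow> ('v \<Rightarrow> 'a) \<Rightarrow> ('v, 'a::comm_ring_1) mps \<Rightarrow> ('w, 'a) mps" where
  "mps_rename b c F = Abs_mps (\<lambda>M. if set_mset M \<subseteq> range b
     then let P = image_mset (inv b) M in prod_mset (image_mset c P) * mps_nth F P else 0)"

text \<open>The case split behind coefficientwise proofs about \<open>mps_rename\<close>: a monomial
  that uses only variables from \<open>range b\<close> can be pulled back along
  \<open>inv b\<close>; on all others the renamed series vanishes.\<close>

lemma mset_renaming_cases: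
  obtains P where "M = image_mset b P" | "\<not> set_mset M \<subseteq> range b"
proof (cases "set_mset M \<subseteq> range b")
  case True
  then have "image_mset b (image_mset (inv b) M) = image_mset id M"
    unfolding multiset.map_comp by (intro image_mset_cong) (auto simp: f_inv_into_f)
  with that(1)[of "image_mset (inv b) M"] show ?thesis by simp
qed (use that in blast)

context
  fixes b :: "'v \<Rightarrow> 'w" and c :: "'v \<Rightarrow> 'a::comm_ring_1"
  assumes inj_b: "inj b"
begin

lemma mps_nth_rename_image:
  "mps_nth (mps_rename b c F) (image_mset b P) = prod_mset (image_mset c P) * mps_nth F P"
proof -
  have "image_mset (inv b) (image_mset b P) = P"
    by (simp add: multiset.map_comp inj_b)
  then show ?thesis by (auto simp: mps_rename_def Abs_mps_inverse Let_def)
qed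

lemma mps_nth_rename_outside:
  "\<not> set_mset M \<subseteq> range b \<Longrightarrow> mps_nth (mps_rename b c F) M = 0"
  by (simp add: mps_rename_def Abs_mps_inverse)

lemmas mps_nth_rename = mps_nth_rename_image mps_nth_rename_outside

lemma mps_rename_eqI:
  assumes "\<And>P. mps_nth G (image_mset b P) = prod_mset (image_mset c P) * mps_nth F P"
    and "\<And>M. \<not> set_mset M \<subseteq> range b \<Longrightarrow> mps_nth G M = 0"
  shows "mps_rename b c F = G"
proof (rule mps_eqI)
  fix M
  show "mps_nth (mps_rename b c F) M = mps_nth G M"
    by (rule mset_renaming_cases[of M b]) (auto simp: mps_nth_rename assms)
qed

lemma image_mset_eq_iff: "image_mset b P = image_mset b P' \<longleftrightarrow> P = P'"
proof
  assume *: "image_mset b P = image_mset b P'"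
  have "image_mset (inv b) (image_mset b X) = X" for X
    by (simp add: multiset.map_comp inj_b)
  then show "P = P'" using * by metis
qed simp

lemma image_mset_subseteq_iff: "image_mset b P \<subseteq># image_mset b P' \<longleftrightarrow> P \<subseteq># P'"
proof
  assume *: "image_mset b P \<subseteq># image_mset b P'"
  have "image_mset (inv b) (image_mset b X) = X" for X
    by (simp add: multiset.map_comp inj_b)
  then show "P \<subseteq># P'" using image_mset_subseteq_mono[OF *, of "inv b"] by simp
qed (rule image_mset_subseteq_mono)

lemma mps_rename_const: "mps_rename b c (mps_const x) = mps_const x"
  by (rule mps_rename_eqI) auto

lemma mps_rename_0 [simp]: "mps_rename b c 0 = 0"
  and mps_rename_1 [simp]: "mps_rename b c 1 = 1"
  using mps_rename_const[of 0] mps_rename_const[of 1] by simp_all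

lemma mps_rename_var: "mps_rename b c (mps_var v) = mps_const (c v) * mps_var (b v)"
proof (rule mps_rename_eqI)
  fix P
  have "image_mset b P = {#b v#} \<longleftrightarrow> P = {#v#}"
    using image_mset_eq_iff[of P "{#v#}"] by simp
  then show "mps_nth (mps_const (c v) * mps_var (b v)) (image_mset b P) =
      prod_mset (image_mset c P) * mps_nth (mps_var v) P"
    by auto
qed auto

lemma mps_rename_sum: "mps_rename b c (sum f A) = (\<Sum>i\<in>A. mps_rename b c (f i))"
  by (rule mps_rename_eqI) (simp_all add: mps_nth_rename sum_distrib_left)

text \<open>By injectivity the divisors of a renamed monomial correspond one to one to the divisors
  of the original, and the scaling factors of the two parts of \<open>P = A + B\<close> multiply to
  that of \<open>P\<close>.\<close>

lemma mps_rename_mult: "mps_rename b c (F * G) = mps_rename b c F * mps_rename b c G"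
proof (rule mps_rename_eqI)
  fix P
  have sub: "{A. A \<subseteq># image_mset b P} = image_mset b ` {A. A \<subseteq># P}"
  proof (intro equalityI subsetI)
    fix A assume "A \<in> {A. A \<subseteq># image_mset b P}"
    moreover from this have "set_mset A \<subseteq> range b"
      using set_mset_mono by fastforce
    then obtain A' where "A = image_mset b A'"
      by (rule_tac mset_renaming_cases[of A b]) auto
    ultimately show "A \<in> image_mset b ` {A. A \<subseteq># P}"
      by (auto simp: image_mset_subseteq_iff)
  qed (auto intro: image_mset_subseteq_mono)
  have "mps_nth (mps_rename b c F * mps_rename b c G) (image_mset b P) =
      (\<Sum>A | A \<subseteq># P. mps_nth (mps_rename b c F) (image_mset b A) *
         mps_nth (mps_rename b c G) (image_mset b P - image_mset b A))"
    unfolding times_mps.rep_eq sub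
    by (subst sum.reindex) (auto intro!: inj_onI simp: image_mset_eq_iff)
  also have "\<dots> = (\<Sum>A | A \<subseteq># P. prod_mset (image_mset c P) * (mps_nth F A * mps_nth G (P - A)))"
  proof (intro sum.cong refl)
    fix A assume "A \<in> {A. A \<subseteq># P}"
    then obtain B where P: "P = A + B" by (auto simp: mset_subset_eq_exists_conv)
    show "mps_nth (mps_rename b c F) (image_mset b A) *
         mps_nth (mps_rename b c G) (image_mset b P - image_mset b A) =
       prod_mset (image_mset c P) * (mps_nth F A * mps_nth G (P - A))"
      by (simp add: P mps_nth_rename)
  qed
  also have "\<dots> = prod_mset (image_mset c P) * mps_nth (F * G) P"
    by (simp add: times_mps.rep_eq sum_distrib_left)
  finally show "mps_nth (mps_rename b c F * mps_rename b c G) (image_mset b P) =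
      prod_mset (image_mset c P) * mps_nth (F * G) P" .
next
  fix M assume M: "\<not> set_mset M \<subseteq> range b"
  have "mps_nth (mps_rename b c F) A * mps_nth (mps_rename b c G) (M - A) = 0" if "A \<subseteq># M" for A
  proof -
    have "set_mset M = set_mset A \<union> set_mset (M - A)"
      using that by (metis set_mset_union subset_mset.add_diff_inverse)
    with M have "\<not> set_mset A \<subseteq> range b \<or> \<not> set_mset (M - A) \<subseteq> range b" by auto
    then show ?thesis by (elim disjE) (simp_all add: mps_nth_rename_outside)
  qed
  then show "mps_nth (mps_rename b c F * mps_rename b c G) M = 0"
    by (simp add: times_mps.rep_eq)
qed

lemma mps_rename_prod_list:
  "mps_rename b c (prod_list fs) = prod_list (map (mps_rename b c) fs)"
  by (induction fs) (auto simp: mps_rename_mult)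

text \<open>Chain rule for the substitution. Injectivity preserves multiplicities, and the extra
  variable in \<open>add_mset v P\<close> accounts for the factor \<open>c v\<close>.\<close>

lemma mps_deriv_rename:
  "mps_deriv (b v) (mps_rename b c F) = mps_const (c v) * mps_rename b c (mps_deriv v F)"
proof (rule mps_eqI)
  fix M
  show "mps_nth (mps_deriv (b v) (mps_rename b c F)) M =
      mps_nth (mps_const (c v) * mps_rename b c (mps_deriv v F)) M"
  proof (rule mset_renaming_cases[of M b])
    fix P assume M: "M = image_mset b P"
    have "mps_nth (mps_rename b c F) (add_mset (b v) M) =
        c v * prod_mset (image_mset c P) * mps_nth F (add_mset v P)"
      using mps_nth_rename_image[of F "add_mset v P"] M by simp
    moreover have "count M (b v) = count P v"
      unfolding M by (induction P) (use inj_b in \<open>auto dest: injD\<close>)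
    ultimately show ?thesis by (simp add: M mps_nth_rename algebra_simps)
  qed (simp add: mps_nth_rename_outside)
qed

end

text \<open>Since no scaling factor vanishes and there are no zero divisors, each coefficient is
  only multiplied by a nonzero constant, so the same indices contribute to the formal sum before and
  after renaming.\<close>

lemma mps_rename_infsum:
  fixes c :: "'v \<Rightarrow> 'a::idom"
  assumes b: "inj b" and c: "\<And>v. c v \<noteq> 0"
  shows "mps_rename b c (mps_infsum X I) = mps_infsum (\<lambda>i. mps_rename b c (X i)) I"
proof (rule mps_rename_eqI[OF b])
  fix P
  have "prod_mset (image_mset c P) \<noteq> 0" using c by auto
  then show "mps_nth (mps_infsum (\<lambda>i. mps_rename b c (X i)) I) (image_mset b P) =
      prod_mset (image_mset c P) * mps_nth (mps_infsum X I) P"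
    by (simp add: mps_nth_infsum mps_nth_rename[OF b] sum_distrib_left)
qed (simp add: mps_nth_infsum mps_nth_rename_outside[OF b])

lemma mps_rename_injective:
  fixes c :: "'v \<Rightarrow> 'a::idom"
  assumes b: "inj b" and c: "\<And>v. c v \<noteq> 0" and eq: "mps_rename b c F = mps_rename b c G"
  shows "F = G"
proof (rule mps_eqI)
  fix P
  have "prod_mset (image_mset c P) \<noteq> 0" using c by auto
  then show "mps_nth F P = mps_nth G P"
    using arg_cong[OF eq, of "\<lambda>H. mps_nth H (image_mset b P)"] by (simp add: mps_nth_rename_image[OF b])
qed


section \<open>Coefficient series\<close>

text \<open>Reduces evaluation at scaled variables to one substitution. It serves twice: for the
  flat coordinates of the potential and for the jet variables \<open>JP\<close>.\<close>

lemma coeff_series_rename: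
  assumes b: "inj b" and c: "\<And>v. c v \<noteq> 0"
    and x: "\<And>\<gamma>. \<gamma> \<in> \<Gamma> \<Longrightarrow> x \<gamma> = mps_const (c \<gamma>) * mps_var (b \<gamma>)"
  shows "coeff_series R \<alpha> \<beta> \<Gamma> x = mps_rename b c (coeff_series R \<alpha> \<beta> \<Gamma> mps_var)"
proof -
  have "prod_list (map x \<gamma>s) = prod_list (map (mps_rename b c \<circ> mps_var) \<gamma>s)" if "set \<gamma>s \<subseteq> \<Gamma>" for \<gamma>s
    using that by (intro arg_cong[where f = prod_list] map_cong) (auto simp: x mps_rename_var[OF b])
  then show ?thesis
    unfolding coeff_series_def mps_rename_infsum[OF b c]
    by (intro mps_infsum_cong)
      (simp add: mps_rename_mult[OF b] mps_rename_const[OF b] mps_rename_prod_list[OF b])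
qed

lemma coeff_series_restrict:
  assumes "\<And>\<gamma>s. set \<gamma>s \<subseteq> \<Gamma> \<Longrightarrow> \<not> set \<gamma>s \<subseteq> \<Gamma>' \<Longrightarrow> R \<alpha> \<beta> \<gamma>s = 0" and "\<Gamma>' \<subseteq> \<Gamma>"
  shows "coeff_series R \<alpha> \<beta> \<Gamma> x = coeff_series R \<alpha> \<beta> \<Gamma>' x"
  unfolding coeff_series_def
proof (rule mps_infsum_mono_neutral)
  fix \<gamma>s assume "\<gamma>s \<in> {\<gamma>s. \<gamma>s \<noteq> [] \<and> set \<gamma>s \<subseteq> \<Gamma>} - {\<gamma>s. \<gamma>s \<noteq> [] \<and> set \<gamma>s \<subseteq> \<Gamma>'}"
  then have "R \<alpha> \<beta> \<gamma>s = 0" using assms(1) by blast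
  then show "mps_const (R \<alpha> \<beta> \<gamma>s) * prod_list (map x \<gamma>s) = 0" by simp
qed (use assms(2) in auto)

lemma mps_deriv_coeff_series_eq_0:
  assumes "v \<notin> \<Gamma>"
  shows "mps_deriv v (coeff_series R \<alpha> \<beta> \<Gamma> mps_var) = 0"
proof (rule mps_eqI)
  fix M
  have "mps_nth (coeff_series R \<alpha> \<beta> \<Gamma> mps_var) (add_mset v M) = 0"
    unfolding coeff_series_def mps_nth_infsum
  proof (intro sum.neutral ballI)
    fix \<gamma>s
    assume "\<gamma>s \<in> {\<gamma>s \<in> {\<gamma>s. \<gamma>s \<noteq> [] \<and> set \<gamma>s \<subseteq> \<Gamma>}.
      mps_nth (mps_const (R \<alpha> \<beta> \<gamma>s) * prod_list (map mps_var \<gamma>s)) (add_mset v M) \<noteq> 0}"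
    then have "set \<gamma>s \<subseteq> \<Gamma>" by blast
    moreover have "v \<in> set \<gamma>s" if "add_mset v M = mset \<gamma>s"
      using that by (metis set_mset_mset union_single_eq_member)
    ultimately show "mps_nth (mps_const (R \<alpha> \<beta> \<gamma>s) * prod_list (map mps_var \<gamma>s)) (add_mset v M) = 0"
      using assms by (auto simp: mps_nth_prod_list_var)
  qed
  then show "mps_nth (mps_deriv v (coeff_series R \<alpha> \<beta> \<Gamma> mps_var)) M = mps_nth 0 M" by simp
qed


section \<open>Stable coefficients and the variables that occur in them\<close>

context
  fixes R :: "nat \<Rightarrow> nat \<Rightarrow> nat list \<Rightarrow> complex"
begin

text \<open>This is Q_{\<alpha>\<beta>} with variables indexed by plain numbers, so that it can be
  specialized both to the coordinates s of a potential and to the jet variables p.\<close>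

definition stable_series :: "nat \<Rightarrow> nat \<Rightarrow> (nat, complex) mps" where
  "stable_series \<alpha> \<beta> = coeff_series R \<alpha> \<beta> {1..} mps_var"

definition indices_bounded :: "nat \<Rightarrow> nat \<Rightarrow> nat \<Rightarrow> bool" where
  "indices_bounded K \<alpha> \<beta> \<longleftrightarrow>
     (\<forall>\<gamma>s. set \<gamma>s \<subseteq> {1..} \<and> (\<exists>\<gamma>\<in>set \<gamma>s. \<gamma> > K) \<longrightarrow> R \<alpha> \<beta> \<gamma>s = 0)"

definition stable_up_to :: "nat \<Rightarrow> nat \<Rightarrow> (nat, complex) mps \<Rightarrow> bool" where
  "stable_up_to B N F \<longleftrightarrow> (\<forall>\<alpha>\<in>{1..B}. \<forall>\<beta>\<in>{1..B}. indices_bounded N \<alpha> \<beta> \<and>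
     mps_deriv \<alpha> (mps_deriv \<beta> F) =
       coeff_series R \<alpha> \<beta> {1..N} (\<lambda>\<gamma>. mps_deriv 1 (mps_deriv \<gamma> F)))"

lemma stable_series_bounded:
  assumes "indices_bounded K \<alpha> \<beta>"
  shows "stable_series \<alpha> \<beta> = coeff_series R \<alpha> \<beta> {1..K} mps_var"
  unfolding stable_series_def
proof (rule coeff_series_restrict)
  fix \<gamma>s assume "set \<gamma>s \<subseteq> {1..}" "\<not> set \<gamma>s \<subseteq> {1..K}"
  moreover from this have "\<exists>\<gamma>\<in>set \<gamma>s. \<gamma> > K" by force
  ultimately show "R \<alpha> \<beta> \<gamma>s = 0" using assms unfolding indices_bounded_def by blast
qed auto

lemma mps_deriv_stable_series_eq_0:
  assumes "indices_bounded K \<alpha> \<beta>" "\<nu> \<notin> {1..K}"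
  shows "mps_deriv \<nu> (stable_series \<alpha> \<beta>) = 0"
  unfolding stable_series_bounded[OF assms(1)] by (rule mps_deriv_coeff_series_eq_0[OF assms(2)])

text \<open>As \<kappa>1 is positive, the stability bound grows without limit, so a single dimension
  makes the whole square of index pairs up to \<open>B\<close> stable.\<close>

lemma stable_coefficients_eventually:
  assumes "stable_coefficients Nmin F R"
  obtains N where "N \<ge> Nmin" "N \<ge> B" "stable_up_to B N (F N)"
proof -
  from assms obtain \<kappa>1 \<kappa>0 :: rat where \<kappa>: "\<kappa>1 > 0" and
    *: "\<forall>N\<ge>Nmin. \<forall>\<alpha>\<in>{1..N}. \<forall>\<beta>\<in>{1..N}. of_nat (\<alpha> + \<beta>) \<le> \<kappa>1 * of_nat N + \<kappa>0 \<longrightarrow>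
           mps_deriv \<alpha> (mps_deriv \<beta> (F N)) =
             coeff_series R \<alpha> \<beta> {1..N} (\<lambda>\<gamma>. mps_deriv 1 (mps_deriv \<gamma> (F N))) \<and>
           (\<forall>\<gamma>s. set \<gamma>s \<subseteq> {1..} \<and> (\<exists>\<gamma>\<in>set \<gamma>s. \<gamma> > N) \<longrightarrow> R \<alpha> \<beta> \<gamma>s = 0)"
    unfolding stable_coefficients_def by (elim conjE exE) (rule that)
  \<comment> \<open>The largest index sum in the square is \<open>B + B\<close>; solving the
    stability inequality for the dimension gives this threshold.\<close>
  obtain n :: nat where n: "(of_nat (B + B) - \<kappa>0) / \<kappa>1 \<le> of_nat n"
    using real_arch_simple by blast
  define N where "N = max n (max Nmin B)"
  have N: "of_nat (B + B) \<le> \<kappa>1 * of_nat N + \<kappa>0"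
  proof -
    have "(of_nat (B + B) - \<kappa>0) / \<kappa>1 \<le> of_nat N"
      using n by (rule order_trans) (simp add: N_def)
    then show ?thesis using \<kappa> by (simp add: field_simps)
  qed
  have "stable_up_to B N (F N)"
    unfolding stable_up_to_def
  proof (intro ballI)
    fix \<alpha> \<beta> assume ab: "\<alpha> \<in> {1..B}" "\<beta> \<in> {1..B}"
    then have "(of_nat (\<alpha> + \<beta>) :: rat) \<le> of_nat (B + B)" by (subst of_nat_le_iff) auto
    then have "of_nat (\<alpha> + \<beta>) \<le> \<kappa>1 * of_nat N + \<kappa>0" using N by linarith
    moreover have "N \<ge> Nmin" "\<alpha> \<in> {1..N}" "\<beta> \<in> {1..N}" using ab by (auto simp: N_def)
    ultimately show "indices_bounded N \<alpha> \<beta> \<and> mps_deriv \<alpha> (mps_deriv \<beta> (F N)) =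
       coeff_series R \<alpha> \<beta> {1..N} (\<lambda>\<gamma>. mps_deriv 1 (mps_deriv \<gamma> (F N)))"
      using * unfolding indices_bounded_def by blast
  qed
  then show ?thesis by (rule that[rotated 2]) (auto simp: N_def)
qed


section \<open>From the WDVV equations to the coefficients\<close>

text \<open>Identifies \<partial>1\<partial>\<gamma> F with the linear coordinate s_\<gamma>.
  Differentiating the quadratic form yields two sums, equal by symmetry of \<eta>, which the factor
  1/2 reduces to one.\<close>

lemma frobenius_potential_deriv_1:
  assumes "frobenius_potential N \<eta> F" "\<gamma> \<in> {1..N}"
  shows "mps_deriv 1 (mps_deriv \<gamma> F) = (\<Sum>\<beta>=1..N. mps_const (\<eta> \<gamma> \<beta>) * mps_var \<beta>)"
proof -
  have sym: "\<eta> \<alpha> \<gamma> = \<eta> \<gamma> \<alpha>" if "\<alpha> \<in> {1..N}" for \<alpha>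
    using assms that unfolding frobenius_potential_def by blast
  have d1: "mps_deriv 1 F =
      mps_const (1/2) * (\<Sum>\<alpha>=1..N. \<Sum>\<beta>=1..N. mps_const (\<eta> \<alpha> \<beta>) * (mps_var \<alpha> * mps_var \<beta>))"
    using assms(1) unfolding frobenius_potential_def by (simp add: mult.assoc)
  define S where "S = (\<Sum>\<beta>=1..N. mps_const (\<eta> \<gamma> \<beta>) * mps_var \<beta> :: (nat, complex) mps)"
  have "mps_deriv \<gamma> (mps_deriv 1 F) = mps_const (1/2) *
      ((\<Sum>\<alpha>=1..N. \<Sum>\<beta>=1..N. mps_const (\<eta> \<alpha> \<beta>) * (if \<gamma> = \<alpha> then mps_var \<beta> else 0)) +
       (\<Sum>\<alpha>=1..N. \<Sum>\<beta>=1..N. mps_const (\<eta> \<alpha> \<beta>) * (if \<gamma> = \<beta> then mps_var \<alpha> else 0)))"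
    unfolding d1 mps_deriv_const_mult mps_deriv_sum mps_deriv_var_mult_var
    by (simp only: distrib_left sum.distrib)
  also have "(\<Sum>\<alpha>=1..N. \<Sum>\<beta>=1..N. mps_const (\<eta> \<alpha> \<beta>) * (if \<gamma> = \<alpha> then mps_var \<beta> else 0)) = S"
    using assms(2) by (subst sum.swap) (simp add: S_def if_distrib cong: if_cong)
  also have "(\<Sum>\<alpha>=1..N. \<Sum>\<beta>=1..N. mps_const (\<eta> \<alpha> \<beta>) * (if \<gamma> = \<beta> then mps_var \<alpha> else 0)) = S"
    using assms(2) by (auto simp: S_def if_distrib sym cong: if_cong intro!: sum.cong)
  also have "mps_const (1/2) * (S + S) = S"
    by (rule mps_eqI) (simp only: mps_nth_const_mult plus_mps.rep_eq, simp)
  finally show ?thesis by (simp add: S_def mps_deriv_commute)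
qed

text \<open>
  Every row of \<open>\<eta>\<close> has exactly one nonzero entry, so \<open>s\<^sub>\<alpha>\<close> is a scaled coordinate \<open>t\<^bsub>b \<alpha>\<^esub>\<close>. Extending
  \<open>b\<close> and the scaling factors beyond \<open>{1..N}\<close> in a nondegenerate way makes the substitution injective.
\<close>

lemma eta_renaming:
  fixes \<eta> :: "nat \<Rightarrow> nat \<Rightarrow> complex"
  assumes row: "one_nonzero_entry_per_row N \<eta>"
    and sym: "\<And>\<alpha> \<beta>. \<alpha> \<in> {1..N} \<Longrightarrow> \<beta> \<in> {1..N} \<Longrightarrow> \<eta> \<alpha> \<beta> = \<eta> \<beta> \<alpha>"
  obtains b :: "nat \<Rightarrow> nat" and c :: "nat \<Rightarrow> complex"
  where "inj b" "\<And>\<alpha>. c \<alpha> \<noteq> 0" "\<And>\<alpha>. b (b \<alpha>) = \<alpha>" "\<And>\<alpha>. \<alpha> \<in> {1..N} \<Longrightarrow> b \<alpha> \<in> {1..N}"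
    "\<And>\<alpha> \<beta>. \<alpha> \<in> {1..N} \<Longrightarrow> \<beta> \<in> {1..N} \<Longrightarrow> \<eta> \<alpha> \<beta> = (if \<beta> = b \<alpha> then c \<alpha> else 0)"
proof -
  have "\<forall>\<alpha>\<in>{1..N}. \<exists>\<beta>. \<beta> \<in> {1..N} \<and> \<eta> \<alpha> \<beta> \<noteq> 0 \<and> (\<forall>\<beta>'\<in>{1..N}. \<eta> \<alpha> \<beta>' \<noteq> 0 \<longrightarrow> \<beta>' = \<beta>)"
    using row unfolding one_nonzero_entry_per_row_def by (metis (no_types))
  then obtain b0 where b0: "\<And>\<alpha>. \<alpha> \<in> {1..N} \<Longrightarrow> b0 \<alpha> \<in> {1..N} \<and> \<eta> \<alpha> (b0 \<alpha>) \<noteq> 0 \<and>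
      (\<forall>\<beta>'\<in>{1..N}. \<eta> \<alpha> \<beta>' \<noteq> 0 \<longrightarrow> \<beta>' = b0 \<alpha>)"
    by metis
  define b where "b \<alpha> = (if \<alpha> \<in> {1..N} then b0 \<alpha> else \<alpha>)" for \<alpha>
  define c where "c \<alpha> = (if \<alpha> \<in> {1..N} then \<eta> \<alpha> (b0 \<alpha>) else 1)" for \<alpha>
  \<comment> \<open>By symmetry the entry of \<eta> at \<open>(b0 \<alpha>, \<alpha>)\<close> is
    nonzero too, so uniqueness in row \<open>b0 \<alpha>\<close> makes \<open>b\<close> an
    involution.\<close>
  have bb: "b (b \<alpha>) = \<alpha>" for \<alpha>
  proof (cases "\<alpha> \<in> {1..N}")
    case True
    then have "b0 \<alpha> \<in> {1..N}" "\<eta> (b0 \<alpha>) \<alpha> \<noteq> 0" using b0 sym by metis+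
    then have "b0 (b0 \<alpha>) = \<alpha>" using b0 True by metis
    then show ?thesis using True \<open>b0 \<alpha> \<in> {1..N}\<close> by (auto simp: b_def)
  qed (auto simp: b_def)
  show ?thesis
  proof (rule that)
    show "inj b" by (metis bb injI)
    show "c \<alpha> \<noteq> 0" for \<alpha> using b0 by (auto simp: c_def)
    show "\<And>\<alpha>. \<alpha> \<in> {1..N} \<Longrightarrow> b \<alpha> \<in> {1..N}" unfolding b_def using b0 by metis
    show "\<eta> \<alpha> \<beta> = (if \<beta> = b \<alpha> then c \<alpha> else 0)" if "\<alpha> \<in> {1..N}" "\<beta> \<in> {1..N}" for \<alpha> \<beta>
      using b0[OF that(1)] that unfolding b_def c_def by metis
  qed (rule bb)
qed

text \<open>With a single entry per row, s_\<gamma> is \<open>c \<gamma>\<close> times the variable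
  \<open>b \<gamma>\<close>, so evaluating Q_{\<alpha>\<beta>} at s is exactly the substitution
  \<open>mps_rename b c\<close>.\<close>

lemma stable_deriv_rename:
  assumes b: "inj b" and c: "\<And>\<alpha>. c \<alpha> \<noteq> 0"
    and b_range: "\<And>\<alpha>. \<alpha> \<in> {1..N} \<Longrightarrow> b \<alpha> \<in> {1..N}"
    and \<eta>: "\<And>\<alpha> \<beta>. \<alpha> \<in> {1..N} \<Longrightarrow> \<beta> \<in> {1..N} \<Longrightarrow> \<eta> \<alpha> \<beta> = (if \<beta> = b \<alpha> then c \<alpha> else 0)"
    and F: "frobenius_potential N \<eta> F"
    and bounded: "indices_bounded N \<alpha> \<beta>"
    and stable: "mps_deriv \<alpha> (mps_deriv \<beta> F) =
       coeff_series R \<alpha> \<beta> {1..N} (\<lambda>\<gamma>. mps_deriv 1 (mps_deriv \<gamma> F))"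
  shows "mps_deriv \<alpha> (mps_deriv \<beta> F) = mps_rename b c (stable_series \<alpha> \<beta>)"
  unfolding stable stable_series_bounded[OF bounded]
proof (rule coeff_series_rename[OF b c])
  fix \<gamma> assume \<gamma>: "\<gamma> \<in> {1..N}"
  have "mps_deriv 1 (mps_deriv \<gamma> F) = (\<Sum>\<beta>=1..N. if \<beta> = b \<gamma> then mps_const (c \<gamma>) * mps_var (b \<gamma>) else 0)"
    unfolding frobenius_potential_deriv_1[OF F \<gamma>] by (intro sum.cong refl) (simp add: \<eta>[OF \<gamma>])
  then show "mps_deriv 1 (mps_deriv \<gamma> F) = mps_const (c \<gamma>) * mps_var (b \<gamma>)"
    using b_range[OF \<gamma>] by simp
qed

text \<open>The bound \<open>K\<close> confines the summation index \<nu> to a range in which all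
  pairs with \<beta> and \<gamma> are stable. WDVV with fourth index \<open>b \<kappa>\<close> then
  becomes an identity of substituted series, and the substitution is injective.\<close>

lemma stable_series_wdvv:
  assumes F: "frobenius_potential N \<eta> F" and row: "one_nonzero_entry_per_row N \<eta>"
    and K: "K \<le> N" and idx: "{\<alpha>, \<beta>, \<gamma>} \<subseteq> {1..K}" "\<kappa> \<in> {1..N}"
    and supp: "indices_bounded K \<alpha> \<beta>" "indices_bounded K \<alpha> \<gamma>"
    and stable: "stable_up_to K N F"
  shows "(\<Sum>\<nu>=1..K. mps_deriv \<nu> (stable_series \<alpha> \<beta>) * mps_deriv \<kappa> (stable_series \<nu> \<gamma>)) =
         (\<Sum>\<nu>=1..K. mps_deriv \<nu> (stable_series \<alpha> \<gamma>) * mps_deriv \<kappa> (stable_series \<nu> \<beta>))"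
proof -
  have sym: "\<eta> \<alpha> \<beta> = \<eta> \<beta> \<alpha>" if "\<alpha> \<in> {1..N}" "\<beta> \<in> {1..N}" for \<alpha> \<beta>
    using F that unfolding frobenius_potential_def by blast
  obtain b c where b: "inj b" and c: "\<And>\<alpha>. c \<alpha> \<noteq> 0" and bb: "\<And>\<alpha>. b (b \<alpha>) = \<alpha>"
    and b_range: "\<And>\<alpha>. \<alpha> \<in> {1..N} \<Longrightarrow> b \<alpha> \<in> {1..N}"
    and \<eta>: "\<And>\<alpha> \<beta>. \<alpha> \<in> {1..N} \<Longrightarrow> \<beta> \<in> {1..N} \<Longrightarrow> \<eta> \<alpha> \<beta> = (if \<beta> = b \<alpha> then c \<alpha> else 0)"
    using eta_renaming[OF row sym] by blast
  obtain \<eta>inv where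
    inv: "\<And>\<alpha> \<beta>. \<alpha> \<in> {1..N} \<Longrightarrow> \<beta> \<in> {1..N} \<Longrightarrow>
      (\<Sum>\<mu>=1..N. \<eta> \<alpha> \<mu> * \<eta>inv \<mu> \<beta>) = (if \<alpha> = \<beta> then 1 else 0)" and
    wdvv: "\<And>\<alpha> \<beta> \<gamma> \<sigma>. \<alpha> \<in> {1..N} \<Longrightarrow> \<beta> \<in> {1..N} \<Longrightarrow> \<gamma> \<in> {1..N} \<Longrightarrow> \<sigma> \<in> {1..N} \<Longrightarrow>
      (\<Sum>\<mu>=1..N. \<Sum>\<nu>=1..N. mps_deriv \<alpha> (mps_deriv \<beta> (mps_deriv \<mu> F)) * mps_const (\<eta>inv \<mu> \<nu>) *
         mps_deriv \<nu> (mps_deriv \<gamma> (mps_deriv \<sigma> F))) =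
      (\<Sum>\<mu>=1..N. \<Sum>\<nu>=1..N. mps_deriv \<alpha> (mps_deriv \<gamma> (mps_deriv \<mu> F)) * mps_const (\<eta>inv \<mu> \<nu>) *
         mps_deriv \<nu> (mps_deriv \<beta> (mps_deriv \<sigma> F)))"
    using F unfolding frobenius_potential_def by blast
  \<comment> \<open>Row \<kappa> of \<eta> has its only nonzero entry at \<open>b \<kappa>\<close>,
    so the matrix product with the inverse collapses to one term.\<close>
  have inv_b: "c \<kappa> * \<eta>inv (b \<kappa>) \<nu> = (if \<kappa> = \<nu> then 1 else 0)" if "\<kappa> \<in> {1..N}" "\<nu> \<in> {1..N}" for \<kappa> \<nu>
  proof -
    have "(\<Sum>\<mu>=1..N. \<eta> \<kappa> \<mu> * \<eta>inv \<mu> \<nu>) = (\<Sum>\<mu>=1..N. if \<mu> = b \<kappa> then c \<kappa> * \<eta>inv (b \<kappa>) \<nu> else 0)"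
      using that by (intro sum.cong) (auto simp: \<eta>)
    then show ?thesis using inv[OF that] b_range[OF that(1)] by simp
  qed
  \<comment> \<open>The direction \<open>b \<kappa>\<close> is the one along which s_\<kappa>
    varies. Moving this derivative outermost lets the chain rule for the substitution apply.\<close>
  have third: "mps_deriv \<alpha> (mps_deriv \<beta> (mps_deriv (b \<kappa>) F)) =
      mps_const (c \<kappa>) * mps_rename b c (mps_deriv \<kappa> (stable_series \<alpha> \<beta>))"
    if "\<alpha> \<in> {1..K}" "\<beta> \<in> {1..K}" for \<alpha> \<beta> \<kappa>
  proof -
    have "mps_deriv \<alpha> (mps_deriv \<beta> (mps_deriv (b \<kappa>) F)) = mps_deriv (b \<kappa>) (mps_deriv \<alpha> (mps_deriv \<beta> F))"
      by (simp only: mps_deriv_commute[of \<beta> "b \<kappa>"] mps_deriv_commute[of \<alpha> "b \<kappa>"])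
    also have "mps_deriv \<alpha> (mps_deriv \<beta> F) = mps_rename b c (stable_series \<alpha> \<beta>)"
      using stable_deriv_rename[OF b c b_range \<eta> F] stable that
      unfolding stable_up_to_def by blast
    finally show ?thesis by (simp add: mps_deriv_rename[OF b])
  qed
  \<comment> \<open>Stated for arbitrary \<beta> and \<gamma>, because the two sides of WDVV differ
    by exchanging them.\<close>
  have side: "(\<Sum>\<mu>=1..N. \<Sum>\<nu>=1..N. mps_deriv \<alpha> (mps_deriv \<beta> (mps_deriv \<mu> F)) * mps_const (\<eta>inv \<mu> \<nu>) *
         mps_deriv \<nu> (mps_deriv \<gamma> (mps_deriv (b \<kappa>) F))) =
      mps_const (c \<kappa>) * mps_rename b c
        (\<Sum>\<nu>=1..K. mps_deriv \<nu> (stable_series \<alpha> \<beta>) * mps_deriv \<kappa> (stable_series \<nu> \<gamma>))"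
    if ab: "\<alpha> \<in> {1..K}" "\<beta> \<in> {1..K}" and \<gamma>: "\<gamma> \<in> {1..K}" and supp: "indices_bounded K \<alpha> \<beta>" for \<beta> \<gamma>
  proof -
    define D where "D \<nu> = mps_rename b c (mps_deriv \<nu> (stable_series \<alpha> \<beta>))" for \<nu>
    define T where "T \<nu> = mps_deriv \<nu> (mps_deriv \<gamma> (mps_deriv (b \<kappa>) F))" for \<nu>
    have D0: "D \<nu> = 0" if "\<nu> \<notin> {1..K}" for \<nu>
      unfolding D_def using mps_deriv_stable_series_eq_0[OF supp that] by (simp add: mps_rename_0[OF b])
    \<comment> \<open>Substituting \<open>b \<mu>\<close> for \<mu> puts the first factor in the
      form of \<open>third\<close>; its scale \<open>c \<mu>\<close> then cancels against the entry
      of \<open>\<eta>inv\<close>, leaving a Kronecker delta.\<close>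
    have "(\<Sum>\<mu>=1..N. \<Sum>\<nu>=1..N. mps_deriv \<alpha> (mps_deriv \<beta> (mps_deriv \<mu> F)) * mps_const (\<eta>inv \<mu> \<nu>) * T \<nu>) =
        (\<Sum>\<mu>=1..N. \<Sum>\<nu>=1..N. mps_deriv \<alpha> (mps_deriv \<beta> (mps_deriv (b \<mu>) F)) * mps_const (\<eta>inv (b \<mu>) \<nu>) * T \<nu>)"
      by (rule sum.reindex_bij_witness[where i = b and j = b]) (use b_range bb in auto)
    also have "\<dots> = (\<Sum>\<mu>=1..N. \<Sum>\<nu>=1..N. mps_const (c \<mu> * \<eta>inv (b \<mu>) \<nu>) * (D \<mu> * T \<nu>))"
      by (simp add: third[OF ab] D_def mps_const_mult ac_simps)
    also have "\<dots> = (\<Sum>\<mu>=1..N. \<Sum>\<nu>=1..N. if \<mu> = \<nu> then D \<mu> * T \<mu> else 0)"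
      by (intro sum.cong refl) (auto simp: inv_b)
    also have "\<dots> = (\<Sum>\<nu>=1..N. D \<nu> * T \<nu>)" by simp
    also have "\<dots> = (\<Sum>\<nu>=1..K. D \<nu> * T \<nu>)"
      by (rule sum.mono_neutral_right) (use K D0 in auto)
    \<comment> \<open>Only after truncation to \<open>K\<close> is every pair (\<nu>, \<gamma>)
      known to be stable, so that \<open>third\<close> also applies to the second factor.\<close>
    also have "\<dots> = mps_const (c \<kappa>) *
        (\<Sum>\<nu>=1..K. D \<nu> * mps_rename b c (mps_deriv \<kappa> (stable_series \<nu> \<gamma>)))"
      unfolding sum_distrib_left T_def by (intro sum.cong refl) (simp only: third[OF _ \<gamma>] ac_simps)
    finally show ?thesis
      by (simp add: T_def D_def mps_rename_sum[OF b] mps_rename_mult[OF b])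
  qed
  have ab: "\<alpha> \<in> {1..K}" "\<beta> \<in> {1..K}" "\<gamma> \<in> {1..K}" using idx by auto
  have "\<alpha> \<in> {1..N}" "\<beta> \<in> {1..N}" "\<gamma> \<in> {1..N}" "b \<kappa> \<in> {1..N}"
    using idx K b_range by auto
  \<comment> \<open>Both sides carry the same nonzero factor \<open>c \<kappa>\<close>, which is
    cancelled next.\<close>
  note wdvv[OF this, unfolded side[OF ab(1,2) ab(3) supp(1)] side[OF ab(1,3) ab(2) supp(2)]]
  then have "mps_rename b c
        (\<Sum>\<nu>=1..K. mps_deriv \<nu> (stable_series \<alpha> \<beta>) * mps_deriv \<kappa> (stable_series \<nu> \<gamma>)) =
      mps_rename b c
        (\<Sum>\<nu>=1..K. mps_deriv \<nu> (stable_series \<alpha> \<gamma>) * mps_deriv \<kappa> (stable_series \<nu> \<beta>))"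
    by (simp only: mps_const_mult_left_cancel[OF c])
  then show ?thesis by (rule mps_rename_injective[OF b c])
qed


section \<open>Jets\<close>

lemma inj_JP: "inj JP"
  by (simp add: inj_def)

lemma system_rhs_rename: "system_rhs R \<alpha> \<beta> = mps_rename JP (\<lambda>_. 1) (stable_series \<alpha> \<beta>)"
  unfolding system_rhs_def stable_series_def by (rule coeff_series_rename[OF inj_JP]) auto

lemma mps_deriv_system_rhs:
  "mps_deriv (JP \<nu>) (system_rhs R \<alpha> \<beta>) = mps_rename JP (\<lambda>_. 1) (mps_deriv \<nu> (stable_series \<alpha> \<beta>))"
  by (simp add: system_rhs_rename mps_deriv_rename[OF inj_JP])

lemma chain_term_system_rhs_eq_0:
  "indices_bounded K \<alpha> \<beta> \<Longrightarrow> \<nu> \<notin> {1..K} \<Longrightarrow> chain_term v (system_rhs R \<alpha> \<beta>) \<nu> = 0"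
  by (simp add: chain_term_def mps_deriv_system_rhs mps_deriv_stable_series_eq_0 mps_rename_0[OF inj_JP])

text \<open>Only the finitely many variables occurring in Q_{\<alpha>\<beta>} give nonzero terms.
  The arbitrary \<open>v\<close> covers both summability claims of compatibility.\<close>

lemma chain_term_system_rhs_summable:
  "indices_bounded K \<alpha> \<beta> \<Longrightarrow> mps_summable (chain_term v (system_rhs R \<alpha> \<beta>)) {1..}"
  by (rule mps_summable_finite_support[of "{1..K}"]) (auto simp: chain_term_system_rhs_eq_0)

lemma chain_term_system_rhs_infsum:
  assumes "indices_bounded K \<alpha> \<beta>"
  shows "mps_infsum (chain_term v (system_rhs R \<alpha> \<beta>)) {1..} =
    (\<Sum>\<nu>=1..K. mps_rename JP (\<lambda>_. 1) (mps_deriv \<nu> (stable_series \<alpha> \<beta>)) * v \<nu>)"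
proof -
  have "mps_infsum (chain_term v (system_rhs R \<alpha> \<beta>)) {1..} =
      mps_infsum (chain_term v (system_rhs R \<alpha> \<beta>)) {1..K}"
    by (rule mps_infsum_mono_neutral) (auto intro: chain_term_system_rhs_eq_0[OF assms])
  then show ?thesis by (simp add: mps_infsum_finite chain_term_def mps_deriv_system_rhs)
qed

text \<open>Exchanging the two finite sums collects the coefficient of each q_\<kappa>, which is the
  WDVV expression in Q. The common bound \<open>L\<close> for all Q_{\<nu>\<gamma>} makes the range
  of \<kappa> independent of \<nu>.\<close>

lemma jet_d_system_rhs:
  assumes "indices_bounded K \<alpha> \<beta>" and "\<And>\<nu>. \<nu> \<in> {1..K} \<Longrightarrow> indices_bounded L \<nu> \<gamma>"
  shows "jet_d R \<gamma> (system_rhs R \<alpha> \<beta>) =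
    (\<Sum>\<kappa>=1..L. mps_rename JP (\<lambda>_. 1)
       (\<Sum>\<nu>=1..K. mps_deriv \<nu> (stable_series \<alpha> \<beta>) * mps_deriv \<kappa> (stable_series \<nu> \<gamma>)) * mps_var (JQ \<kappa>))"
proof -
  have "jet_d R \<gamma> (system_rhs R \<alpha> \<beta>) =
      (\<Sum>\<nu>=1..K. \<Sum>\<kappa>=1..L. mps_rename JP (\<lambda>_. 1) (mps_deriv \<nu> (stable_series \<alpha> \<beta>)) *
         mps_rename JP (\<lambda>_. 1) (mps_deriv \<kappa> (stable_series \<nu> \<gamma>)) * mps_var (JQ \<kappa>))"
    unfolding jet_d_def chain_term_system_rhs_infsum[OF assms(1)]
    by (intro sum.cong refl)
      (simp only: jet_d1_def chain_term_system_rhs_infsum[OF assms(2)] sum_distrib_left mult.assoc)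
  then show ?thesis
    by (subst (asm) sum.swap)
      (simp add: mps_rename_sum[OF inj_JP] mps_rename_mult[OF inj_JP] sum_distrib_right)
qed

end

section \<open>Compatibility of the stable system\<close>

theorem proposition2p1:
  fixes Nmin :: nat
    and F :: "nat \<Rightarrow> (nat, complex) mps"
    and \<eta> :: "nat \<Rightarrow> nat \<Rightarrow> nat \<Rightarrow> complex"
    and R :: "nat \<Rightarrow> nat \<Rightarrow> nat list \<Rightarrow> complex"
  assumes "Nmin \<ge> 1"
    and "\<And>N. N \<ge> Nmin \<Longrightarrow> frobenius_potential N (\<eta> N) (F N)"
    and "\<And>N. N \<ge> Nmin \<Longrightarrow> one_nonzero_entry_per_row N (\<eta> N)"
    and "stable_coefficients Nmin F R"
  shows "compatible_system R"
  unfolding compatible_system_def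
proof (intro allI impI)
  fix \<alpha> \<beta> \<gamma> :: nat assume ge: "\<alpha> \<ge> 1" "\<beta> \<ge> 1" "\<gamma> \<ge> 1"
  define B where "B = max \<alpha> (max \<beta> \<gamma>)"
  \<comment> \<open>First stage: this dimension serves as a bound on the variables occurring in
    Q_{\<alpha>\<beta>} and Q_{\<alpha>\<gamma>}.\<close>
  obtain K where K: "K \<ge> B" "stable_up_to R B K (F K)"
    using stable_coefficients_eventually[OF assms(4)] by blast
  have bounded: "indices_bounded R K \<alpha> \<beta>" "indices_bounded R K \<alpha> \<gamma>"
    using K(2) ge unfolding stable_up_to_def B_def by auto
  have abc: "\<alpha> \<in> {1..K}" "\<beta> \<in> {1..K}" "\<gamma> \<in> {1..K}" using ge K(1) by (auto simp: B_def)
  \<comment> \<open>Second stage: all pairs up to \<open>K\<close> are stable for this potential, in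
    particular those pairing \<gamma> or \<beta> with any \<nu> up to \<open>K\<close>; the same
    \<open>N\<close> bounds \<kappa>.\<close>
  obtain N where N: "N \<ge> Nmin" "N \<ge> K" and stable: "stable_up_to R K N (F N)"
    using stable_coefficients_eventually[OF assms(4)] by blast
  have N_bounded: "indices_bounded R N \<mu> \<nu>" if "\<mu> \<in> {1..K}" "\<nu> \<in> {1..K}" for \<mu> \<nu>
    using stable that unfolding stable_up_to_def by blast
  have wdvv: "(\<Sum>\<nu>=1..K. mps_deriv \<nu> (stable_series R \<alpha> \<beta>) * mps_deriv \<kappa> (stable_series R \<nu> \<gamma>)) =
      (\<Sum>\<nu>=1..K. mps_deriv \<nu> (stable_series R \<alpha> \<gamma>) * mps_deriv \<kappa> (stable_series R \<nu> \<beta>))"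
    if "\<kappa> \<in> {1..N}" for \<kappa>
    by (rule stable_series_wdvv[OF assms(2,3)[OF N(1)] N(2) _ that bounded stable]) (use abc in auto)
  show "mps_summable (chain_term (\<lambda>\<kappa>. mps_var (JQ \<kappa>)) (system_rhs R \<alpha> \<beta>)) {1..} \<and>
      mps_summable (chain_term (\<lambda>\<nu>. jet_d1 (system_rhs R \<nu> \<gamma>)) (system_rhs R \<alpha> \<beta>)) {1..} \<and>
      jet_d R \<gamma> (system_rhs R \<alpha> \<beta>) = jet_d R \<beta> (system_rhs R \<alpha> \<gamma>)"
  proof (intro conjI)
    have "jet_d R \<gamma> (system_rhs R \<alpha> \<beta>) = (\<Sum>\<kappa>=1..N. mps_rename JP (\<lambda>_. 1)
       (\<Sum>\<nu>=1..K. mps_deriv \<nu> (stable_series R \<alpha> \<beta>) * mps_deriv \<kappa> (stable_series R \<nu> \<gamma>)) * mps_var (JQ \<kappa>))"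
      by (rule jet_d_system_rhs[OF bounded(1)], rule N_bounded[OF _ abc(3)])
    also have "\<dots> = (\<Sum>\<kappa>=1..N. mps_rename JP (\<lambda>_. 1)
       (\<Sum>\<nu>=1..K. mps_deriv \<nu> (stable_series R \<alpha> \<gamma>) * mps_deriv \<kappa> (stable_series R \<nu> \<beta>)) * mps_var (JQ \<kappa>))"
      by (rule sum.cong[OF refl]) (simp only: wdvv)
    also have "\<dots> = jet_d R \<beta> (system_rhs R \<alpha> \<gamma>)"
      by (rule jet_d_system_rhs[OF bounded(2), symmetric], rule N_bounded[OF _ abc(2)])
    finally show "jet_d R \<gamma> (system_rhs R \<alpha> \<beta>) = jet_d R \<beta> (system_rhs R \<alpha> \<gamma>)" .
  qed (rule chain_term_system_rhs_summable[OF bounded(1)])+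
qed

end
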